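(* Let $\ell\ge 2$ and $m\ge 1$ be integers, let $\mathcal{H}_\ell=(V,\mathcal{E})$ be the $\ell$-hyperlattice on $V=\mathbb{Z}_\ell^m$, let $A_{\mathrm{cl}}$ be its clique adjacency matrix and let $L_{\mathrm{cl}}=m(\ell-1)I-A_{\mathrm{cl}}$ denote its clique Laplacian. Then $L_{\mathrm{cl}}$ has exactly $m+1$ distinct eigenvalues $$\lambda_j=j\,\ell,\qquad j=0,1,\dots,m,$$ with multiplicities $$\mathrm{mult}(\lambda_j)=\binom{m}{j}(\ell-1)^j.$$ Moreover, the hyperedge-based Laplacian $$L_h=mI-\frac{1}{\ell-1}A_{\mathrm{cl}}=\frac{1}{\ell-1}L_{\mathrm{cl}}$$ has the same eigenvectors and has eigenvalues $$\mu_j=\frac{j\,\ell}{\ell-1},\qquad j=0,1,\dots,m,$$ with the same multiplicities $\binom{m}{j}(\ell-1)^j$.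
   Context: The $\ell$-hyperlattice in $\mathbb{Z}_\ell^m$ is the hypergraph with vertex set $V=\mathbb{Z}_\ell^m=\{(x_1,\dots,x_m):x_i\in\{0,\dots,\ell-1\}\}$ whose hyperedges are all coordinate lines: for each $i\in\{1,\dots,m\}$ and each choice $x_{\hat i}=(x_1,\dots,x_{i-1},x_{i+1},\dots,x_m)\in\mathbb{Z}_\ell^{m-1}$ of the other coordinates, the hyperedge $$L_i(x_{\hat i})=\{(x_1,\dots,x_{i-1},t,x_{i+1},\dots,x_m):t\in\mathbb{Z}_\ell\}.$$ Each vertex belongs to exactly $m$ hyperedges (one per direction), each of cardinality $\ell$. Clique adjacency matrix: $A_{\mathrm{cl}}(u,u)=0$, and for $u\neq v$, $A_{\mathrm{cl}}(u,v)$ is the number of hyperedges containing both $u$ and $v$. The clique Laplacian is $D_{\mathrm{cl}}-A_{\mathrm{cl}}$ with $D_{\mathrm{cl}}$ the diagonal matrix of row sums of $A_{\mathrm{cl}}$ (here constantly $m(\ell-1)$). The hyperedge-based Laplacian is $D_h-A_h$, where $A_h(u,v)=\sum_{e\ni u,v}\frac{1}{|e|-1}$ for $u\ne v$, $A_h(u,u)=0$, and $D_h$ is the diagonal matrix whose entry at $u$ is the number of hyperedges containing $u$ (here constantly $m$). *)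

theory Defs
  imports
    "Jordan_Normal_Form.Spectral_Radius"
    "Jordan_Normal_Form.Jordan_Normal_Form_Uniqueness"
    "HOL-Library.FuncSet"
begin

definition clique_adj :: "'a set set \<Rightarrow> 'a \<Rightarrow> 'a \<Rightarrow> real" where
  "clique_adj E u v = (if u = v then 0 else real (card {e \<in> E. u \<in> e \<and> v \<in> e}))"

definition clique_deg :: "'a set \<Rightarrow> 'a set set \<Rightarrow> 'a \<Rightarrow> real" where
  "clique_deg V E u = (\<Sum>v\<in>V. clique_adj E u v)"

definition hyperedge_adj :: "'a set set \<Rightarrow> 'a \<Rightarrow> 'a \<Rightarrow> real" where
  "hyperedge_adj E u v =
     (if u = v then 0 else (\<Sum>e\<in>{e \<in> E. u \<in> e \<and> v \<in> e}. 1 / (real (card e) - 1)))"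

definition hyperedge_deg :: "'a set set \<Rightarrow> 'a \<Rightarrow> real" where
  "hyperedge_deg E u = real (card {e \<in> E. u \<in> e})"

text \<open>Matrices are indexed by numbers, so a \<open>V \<times> V\<close> matrix is formed relative to an
  enumeration \<open>vs\<close> of \<open>V\<close>, that is, a distinct list whose set of elements is \<open>V\<close>.\<close>

definition matrix_on :: "'a list \<Rightarrow> ('a \<Rightarrow> 'a \<Rightarrow> real) \<Rightarrow> real mat" where
  "matrix_on vs f = mat (length vs) (length vs) (\<lambda>(i, j). f (vs ! i) (vs ! j))"

definition diagonal_on :: "'a list \<Rightarrow> ('a \<Rightarrow> real) \<Rightarrow> real mat" where
  "diagonal_on vs d = matrix_on vs (\<lambda>u v. if u = v then d u else 0)"

definition clique_adj_mat :: "'a list \<Rightarrow> 'a set set \<Rightarrow> real mat" where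
  "clique_adj_mat vs E = matrix_on vs (clique_adj E)"

definition clique_laplacian :: "'a list \<Rightarrow> 'a set set \<Rightarrow> real mat" where
  "clique_laplacian vs E = diagonal_on vs (clique_deg (set vs) E) - clique_adj_mat vs E"

definition hyperedge_laplacian :: "'a list \<Rightarrow> 'a set set \<Rightarrow> real mat" where
  "hyperedge_laplacian vs E =
     diagonal_on vs (hyperedge_deg E) - matrix_on vs (hyperedge_adj E)"

text \<open>Only the underlying set \<open>{0, \<dots>, l - 1}\<close> of \<open>\<int>/l\<int>\<close> matters.\<close>

definition hyperlattice_verts :: "nat \<Rightarrow> nat \<Rightarrow> (nat \<Rightarrow> nat) set" where
  "hyperlattice_verts l m = {1..m} \<rightarrow>\<^sub>E {0..<l}"

definition coord_line :: "nat \<Rightarrow> nat \<Rightarrow> (nat \<Rightarrow> nat) \<Rightarrow> (nat \<Rightarrow> nat) set" where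
  "coord_line l i y = {y(i := t) | t. t \<in> {0..<l}}"

definition hyperlattice_edges :: "nat \<Rightarrow> nat \<Rightarrow> (nat \<Rightarrow> nat) set set" where
  "hyperlattice_edges l m =
     {coord_line l i y | i y. i \<in> {1..m} \<and> y \<in> ({1..m} - {i}) \<rightarrow>\<^sub>E {0..<l}}"

lemma hyperlattice_enumeration_exists:
  "\<exists>vs. distinct vs \<and> set vs = hyperlattice_verts l m"
  using finite_distinct_list[of "hyperlattice_verts l m"]
  by (auto simp: hyperlattice_verts_def intro: finite_PiE)

text \<open>For the symmetric matrices considered here the algebraic and the geometric multiplicity
  agree; both are required to have the stated value.\<close>

definition has_multiplicity :: "real mat \<Rightarrow> real \<Rightarrow> nat \<Rightarrow> bool" where
  "has_multiplicity A c k \<longleftrightarrow>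
     Polynomial.order c (char_poly A) = k \<and> kernel_dim (char_matrix A c) = k"

end

theory Submission
  imports Defs
begin

text \<open>Off the diagonal, the clique adjacency matrix is the sum over the directions \<open>i\<close> of the
  matrices \<open>J\<^sub>i\<close> that sum a function over the line in direction \<open>i\<close>, so the clique Laplacian is
  \<open>m l - (\<Sum>i. J\<^sub>i)\<close>. On a single copy of \<open>{0, \<dots>, l - 1}\<close> take the rational basis consisting
  of the constant \<open>1 / l\<close> and the functions \<open>\<delta>\<^sub>b - 1 / l\<close> for \<open>b \<noteq> 0\<close>, which have sum \<open>0\<close>. The product
  function indexed by \<open>b\<close> is an eigenvector of \<open>J\<^sub>i\<close> for the value \<open>l\<close> if \<open>b i = 0\<close> and \<open>0\<close>
  otherwise, hence an eigenvector of the Laplacian for \<open>l\<close> times the weight of \<open>b\<close>. The product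
  functions form a basis because the one-dimensional inverse matrix is known explicitly.\<close>

section \<open>Diagonalisation of matrices indexed by a list\<close>

lemma matrix_on_carrier [simp]: "matrix_on vs f \<in> carrier_mat (length vs) (length vs)"
  by (simp add: matrix_on_def)

lemma matrix_on_cong:
  assumes "\<And>u v. u \<in> set vs \<Longrightarrow> v \<in> set vs \<Longrightarrow> f u v = g u v"
  shows "matrix_on vs f = matrix_on vs g"
  by (rule eq_matI) (auto simp: matrix_on_def assms)

lemma matrix_on_mult:
  assumes "distinct vs"
  shows "matrix_on vs f * matrix_on vs g = matrix_on vs (\<lambda>u v. \<Sum>w\<in>set vs. f u w * g w v)"
proof (rule eq_matI)
  fix i j
  assume "i < dim_row (matrix_on vs (\<lambda>u v. \<Sum>w\<in>set vs. f u w * g w v))"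
    and "j < dim_col (matrix_on vs (\<lambda>u v. \<Sum>w\<in>set vs. f u w * g w v))"
  then have ij: "i < length vs" "j < length vs"
    by (simp_all add: matrix_on_def)
  have "(\<Sum>k = 0..<length vs. f (vs ! i) (vs ! k) * g (vs ! k) (vs ! j))
      = (\<Sum>w\<in>set vs. f (vs ! i) w * g w (vs ! j))"
    by (rule sum.reindex_bij_betw)
      (use bij_betw_nth[OF assms, of "{0..<length vs}"] in \<open>auto simp: lessThan_atLeast0\<close>)
  then show "(matrix_on vs f * matrix_on vs g) $$ (i, j)
      = matrix_on vs (\<lambda>u v. \<Sum>w\<in>set vs. f u w * g w v) $$ (i, j)"
    using ij by (simp add: matrix_on_def scalar_prod_def)
qed (simp_all add: matrix_on_def)

lemma matrix_on_of_bool: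
  assumes "distinct vs"
  shows "matrix_on vs (\<lambda>u v. of_bool (u = v)) = 1\<^sub>m (length vs)"
  by (rule eq_matI) (auto simp: matrix_on_def nth_eq_iff_index_eq[OF assms])

text \<open>Lets a diagonalisation be read as a Jordan normal form, whose block sizes give both
  kinds of multiplicity.\<close>

lemma jordan_matrix_size_one:
  "jordan_matrix (map (Pair 1) ds) = mat_diag (length ds) (\<lambda>i. ds ! i)"
proof (induction ds)
  case Nil
  then show ?case
    by (intro eq_matI) (simp_all add: jordan_matrix_def mat_diag_def)
next
  case (Cons a ds)
  have len: "sum_list (map fst (map (Pair 1) ds)) = length ds"
    by (induction ds) auto
  show ?case
    unfolding list.map jordan_matrix_Cons Cons.IH len
    by (rule eq_matI) (auto simp: mat_diag_def nth_Cons split: nat.splits)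
qed

text \<open>The columns of \<open>Q\<close> are eigenvectors, so \<open>L * Q = Q * D\<close> with
  \<open>D\<close> diagonal. A left inverse \<open>P\<close> of a square matrix is two-sided, hence
  \<open>L = Q * D * P\<close> is a similarity.\<close>

lemma jordan_nf_matrix_on:
  fixes P Q L :: "'a \<Rightarrow> 'a \<Rightarrow> real"
  assumes "distinct vs"
    and inv: "\<And>u v. u \<in> set vs \<Longrightarrow> v \<in> set vs \<Longrightarrow> (\<Sum>w\<in>set vs. P u w * Q w v) = of_bool (u = v)"
    and eig: "\<And>u v. u \<in> set vs \<Longrightarrow> v \<in> set vs \<Longrightarrow> (\<Sum>w\<in>set vs. L u w * Q w v) = d v * Q u v"
  shows "jordan_nf (matrix_on vs L) (map (\<lambda>v. (1, d v)) vs)"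
proof -
  let ?n = "length vs" and ?P = "matrix_on vs P" and ?Q = "matrix_on vs Q" and ?L = "matrix_on vs L"
  let ?D = "mat_diag ?n (\<lambda>i. map d vs ! i)"
  have PQ: "?P * ?Q = 1\<^sub>m ?n"
    unfolding matrix_on_mult[OF assms(1)] matrix_on_of_bool[OF assms(1), symmetric]
    by (rule matrix_on_cong) (rule inv)
  then have QP: "?Q * ?P = 1\<^sub>m ?n"
    by (rule mat_mult_left_right_inverse[OF matrix_on_carrier matrix_on_carrier])
  have "?L * ?Q = matrix_on vs (\<lambda>u v. d v * Q u v)"
    unfolding matrix_on_mult[OF assms(1)] by (rule matrix_on_cong) (rule eig)
  also have "\<dots> = ?Q * ?D"
    unfolding mat_diag_mult_right[OF matrix_on_carrier]
    by (rule eq_matI) (auto simp: matrix_on_def)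
  finally have LQ: "?L * ?Q = ?Q * ?D" .
  have "?L = ?L * (?Q * ?P)"
    unfolding QP by (rule right_mult_one_mat[symmetric, OF matrix_on_carrier])
  also have "\<dots> = ?Q * ?D * ?P"
    unfolding LQ[symmetric]
    by (rule assoc_mult_mat[symmetric]) (rule matrix_on_carrier)+
  finally have "?L = ?Q * ?D * ?P" .
  moreover have "{?L, ?D, ?Q, ?P} \<subseteq> carrier_mat ?n ?n"
    by simp
  ultimately have "similar_mat ?L ?D"
    using similar_matI QP PQ by blast
  moreover have "jordan_matrix (map (\<lambda>v. (1, d v)) vs) = ?D"
    using jordan_matrix_size_one[of "map d vs"] by (simp add: o_def)
  ultimately show ?thesis
    unfolding jordan_nf_def by auto
qed

text \<open>The block sizes for \<open>c\<close> add up to the algebraic multiplicity, and the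
  number of these blocks is the geometric one; both agree because every block has size one.\<close>

lemma has_multiplicity_jordan_nf_size_one:
  assumes "distinct vs" and "A \<in> carrier_mat n n" and jnf: "jordan_nf A (map (\<lambda>v. (1, d v)) vs)"
  shows "has_multiplicity A c (card {v \<in> set vs. d v = c})"
proof -
  have len: "length (filter (\<lambda>v. d v = c) vs) = card {v \<in> set vs. d v = c}"
    using distinct_card[of "filter (\<lambda>v. d v = c) vs"] assms(1) by simp
  have "Polynomial.order c (char_poly A) = length (filter (\<lambda>v. d v = c) vs)"
    unfolding jordan_nf_order[OF jnf] by (induction vs) auto
  moreover have "dim_gen_eigenspace A c 1 = length (filter (\<lambda>v. d v = c) vs)"
    unfolding dim_gen_eigenspace[OF jnf] by (induction vs) auto
  \<comment> \<open>At exponent \<open>1\<close> the generalised eigenspace is the kernel of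
    \<open>char_matrix A c\<close> itself.\<close>
  moreover have "char_matrix A c ^\<^sub>m 1 = char_matrix A c"
    using char_matrix_closed[OF assms(2), of c] by simp
  ultimately show ?thesis
    unfolding has_multiplicity_def dim_gen_eigenspace_def len by simp
qed

text \<open>The characteristic polynomial splits into the linear factors with roots
  \<open>d v\<close>.\<close>

lemma spectrum_jordan_nf_size_one:
  fixes A :: "real mat"
  assumes "A \<in> carrier_mat n n" and jnf: "jordan_nf A (map (\<lambda>v. (1, d v)) vs)"
  shows "spectrum A = d ` set vs"
  unfolding spectrum_root_char_poly[OF assms(1)] jordan_nf_char_poly[OF jnf]
  by (auto simp: poly_prod_list prod_list_zero_iff o_def image_iff)

text \<open>The factor \<open>a\<close> cancels from the eigenvector equation. This passes between
  the two Laplacians, which differ by a nonzero scalar.\<close>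

lemma eigenvector_smult:
  fixes A :: "'a :: field mat"
  assumes "A \<in> carrier_mat n n" and "a \<noteq> 0"
  shows "eigenvector (a \<cdot>\<^sub>m A) v (a * c) \<longleftrightarrow> eigenvector A v c"
proof -
  have "(a \<cdot>\<^sub>m A) *\<^sub>v v = (a * c) \<cdot>\<^sub>v v \<longleftrightarrow> A *\<^sub>v v = c \<cdot>\<^sub>v v" if v: "v \<in> carrier_vec n"
  proof -
    have "(a \<cdot>\<^sub>m A) *\<^sub>v v = a \<cdot>\<^sub>v (A *\<^sub>v v)"
      using assms(1) v by (intro eq_vecI) auto
    then show ?thesis
      using assms v by (auto simp: vec_eq_iff)
  qed
  then show ?thesis
    using assms(1) by (auto simp: eigenvector_def)
qed

section \<open>Product functions\<close>

text \<open>In \<open>axis_basis l t b\<close> and \<open>prod_basis l m x b\<close> the last argument \<open>b\<close> indexes the basis.\<close>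

definition axis_basis :: "nat \<Rightarrow> nat \<Rightarrow> nat \<Rightarrow> real" where
  "axis_basis l t b = (if b = 0 then 0 else of_bool (t = b)) + (if b = 0 then 1 else - 1) / real l"

text \<open>The coordinate functionals dual to \<open>axis_basis\<close>: the total sum for the
  constant function, and differences against the value at \<open>0\<close> for the others.\<close>

definition axis_basis_inv :: "nat \<Rightarrow> nat \<Rightarrow> real" where
  "axis_basis_inv a t = (if a = 0 then 1 else of_bool (t = a) - of_bool (t = 0))"

definition prod_basis :: "nat \<Rightarrow> nat \<Rightarrow> (nat \<Rightarrow> nat) \<Rightarrow> (nat \<Rightarrow> nat) \<Rightarrow> real" where
  "prod_basis l m x b = (\<Prod>i\<in>{1..m}. axis_basis l (x i) (b i))"

definition prod_basis_inv :: "nat \<Rightarrow> (nat \<Rightarrow> nat) \<Rightarrow> (nat \<Rightarrow> nat) \<Rightarrow> real" where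
  "prod_basis_inv m a x = (\<Prod>i\<in>{1..m}. axis_basis_inv (a i) (x i))"

text \<open>The Hamming weight.\<close>

definition weight :: "nat \<Rightarrow> (nat \<Rightarrow> nat) \<Rightarrow> nat" where
  "weight m b = card {i \<in> {1..m}. b i \<noteq> 0}"

text \<open>For \<open>b \<noteq> 0\<close> the \<open>l\<close> copies of \<open>- 1 / l\<close>
  cancel the single value \<open>1\<close>; the constant \<open>1 / l\<close> is scaled to have sum
  \<open>1\<close>.\<close>

lemma sum_axis_basis:
  assumes "l > 0" and "b < l"
  shows "(\<Sum>t<l. axis_basis l t b) = of_bool (b = 0)"
  using assms by (auto simp: axis_basis_def sum.distrib)

lemma axis_basis_inverse:
  assumes "l > 0" and "a < l" and "b < l"
  shows "(\<Sum>t<l. axis_basis_inv a t * axis_basis l t b) = of_bool (a = b)"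
proof (cases "a = 0")
  case True
  then show ?thesis
    using sum_axis_basis[OF assms(1,3)] by (auto simp: axis_basis_inv_def)
next
  case False
  have "(\<Sum>t<l. axis_basis_inv a t * axis_basis l t b)
      = (\<Sum>t<l. (if t = a then axis_basis l t b else 0) - (if t = 0 then axis_basis l t b else 0))"
    using False by (intro sum.cong) (auto simp: axis_basis_inv_def)
  also have "\<dots> = axis_basis l a b - axis_basis l 0 b"
    using assms by (simp add: sum_subtractf)
  \<comment> \<open>The constant summand cancels in the difference, and for
    \<open>b \<noteq> 0\<close> the indicator of \<open>b\<close> vanishes at
    \<open>0\<close>.\<close>
  also have "\<dots> = of_bool (a = b)"
    using False by (auto simp: axis_basis_def)
  finally show ?thesis .
qed

text \<open>A sum of product functions over the whole box factors into a product of sums over the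
  axes, which leaves the one-dimensional inverse.\<close>

lemma prod_basis_inverse:
  assumes "l > 0" and a: "a \<in> hyperlattice_verts l m" and b: "b \<in> hyperlattice_verts l m"
  shows "(\<Sum>x\<in>hyperlattice_verts l m. prod_basis_inv m a x * prod_basis l m x b) = of_bool (a = b)"
proof -
  have "(\<Sum>x\<in>hyperlattice_verts l m. prod_basis_inv m a x * prod_basis l m x b)
      = (\<Prod>i\<in>{1..m}. \<Sum>t<l. axis_basis_inv (a i) t * axis_basis l t (b i))"
    by (subst prod_sum_PiE)
      (simp_all add: hyperlattice_verts_def prod_basis_def prod_basis_inv_def prod.distrib
        lessThan_atLeast0)
  also have "\<dots> = (\<Prod>i\<in>{1..m}. of_bool (a i = b i))"
    using assms by (intro prod.cong axis_basis_inverse) (auto simp: hyperlattice_verts_def PiE_mem)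
  also have "\<dots> = of_bool (\<forall>i\<in>{1..m}. a i = b i)"
    by (auto simp: prod_zero_iff)
  \<comment> \<open>Both functions are \<open>undefined\<close> outside \<open>{1..m}\<close>, so
    agreement on the coordinates is equality.\<close>
  also have "(\<forall>i\<in>{1..m}. a i = b i) \<longleftrightarrow> a = b"
    using a b unfolding hyperlattice_verts_def by (metis PiE_ext)
  finally show ?thesis .
qed

text \<open>Along a line in direction \<open>i\<close> only the factor at \<open>i\<close> varies,
  so the sum reduces to one axis.\<close>

lemma sum_line_prod_basis:
  assumes "l > 0" and b: "b \<in> hyperlattice_verts l m" and i: "i \<in> {1..m}"
  shows "(\<Sum>t<l. prod_basis l m (x(i := t)) b) = real l * of_bool (b i = 0) * prod_basis l m x b"
proof -
  let ?R = "\<Prod>k\<in>{1..m} - {i}. axis_basis l (x k) (b k)"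
  have split: "prod_basis l m (x(i := t)) b = axis_basis l t (b i) * ?R" for t
    unfolding prod_basis_def using i by (subst prod.remove[of _ i]) (auto intro!: prod.cong)
  have "b i < l"
    using b i by (auto simp: hyperlattice_verts_def PiE_mem)
  then have "(\<Sum>t<l. prod_basis l m (x(i := t)) b) = of_bool (b i = 0) * ?R"
    unfolding split sum_distrib_right[symmetric] using sum_axis_basis[OF assms(1)] by simp
  \<comment> \<open>If \<open>b i = 0\<close>, the missing factor at \<open>i\<close> is
    \<open>1 / l\<close>, which the eigenvalue \<open>l\<close> compensates.\<close>
  also have "\<dots> = real l * of_bool (b i = 0) * (axis_basis l (x i) (b i) * ?R)"
    using \<open>l > 0\<close> by (auto simp: axis_basis_def)
  also have "axis_basis l (x i) (b i) * ?R = prod_basis l m x b"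
    using split[of "x i"] by simp
  finally show ?thesis .
qed

section \<open>Counting the basis indices of a given weight\<close>

lemma support_PiE:
  fixes b :: "nat \<Rightarrow> nat"
  assumes "S \<subseteq> I" and b: "b \<in> (\<Pi>\<^sub>E i\<in>I. if i \<in> S then {1..<l} else {0})"
  shows "{i \<in> I. b i \<noteq> 0} = S"
proof -
  have "b i \<noteq> 0 \<longleftrightarrow> i \<in> S" if "i \<in> I" for i
    using PiE_mem[OF b that] by (simp split: if_splits)
  then show ?thesis
    using assms(1) by blast
qed

text \<open>The indices are sorted by their support: each of the \<open>m choose j\<close> supports
  leaves \<open>l - 1\<close> nonzero values at each of its \<open>j\<close> places.\<close>

lemma card_weight:
  assumes "l > 0"
  shows "card {b \<in> hyperlattice_verts l m. weight m b = j} = (m choose j) * (l - 1) ^ j"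
proof -
  let ?G = "\<lambda>S. \<Pi>\<^sub>E i\<in>{1..m}. if i \<in> S then {1..<l} else {0}"
  let ?\<S> = "{S. S \<subseteq> {1..m} \<and> card S = j}"
  have "{b \<in> hyperlattice_verts l m. weight m b = j} = (\<Union>S\<in>?\<S>. ?G S)"
  proof (intro equalityI subsetI)
    fix b
    assume b: "b \<in> {b \<in> hyperlattice_verts l m. weight m b = j}"
    then have "b \<in> ?G {i \<in> {1..m}. b i \<noteq> 0}"
      by (auto simp: hyperlattice_verts_def PiE_iff)
    moreover have "{i \<in> {1..m}. b i \<noteq> 0} \<in> ?\<S>"
      using b by (auto simp: weight_def)
    ultimately show "b \<in> (\<Union>S\<in>?\<S>. ?G S)"
      by (rule UN_I[rotated])
  next
    fix b
    assume "b \<in> (\<Union>S\<in>?\<S>. ?G S)"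
    then obtain S where S: "S \<subseteq> {1..m}" "card S = j" and b: "b \<in> ?G S"
      by auto
    have val: "b i \<in> (if i \<in> S then {1..<l} else {0})" if "i \<in> {1..m}" for i
      using b that by (rule PiE_mem)
    have "{i \<in> {1..m}. b i \<noteq> 0} = S"
      using S(1) b by (rule support_PiE)
    moreover have "b i < l" if "i \<in> {1..m}" for i
      using val[OF that] \<open>l > 0\<close> by (auto split: if_splits)
    ultimately show "b \<in> {b \<in> hyperlattice_verts l m. weight m b = j}"
      using b S(2) by (auto simp: hyperlattice_verts_def weight_def PiE_iff)
  qed
  also have "card \<dots> = (\<Sum>S\<in>?\<S>. card (?G S))"
  proof (rule card_UN_disjoint)
    show "finite ?\<S>"
      by simp
    show "\<forall>S\<in>?\<S>. finite (?G S)"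
      by (auto intro!: finite_PiE)
    show "\<forall>S\<in>?\<S>. \<forall>T\<in>?\<S>. S \<noteq> T \<longrightarrow> ?G S \<inter> ?G T = {}"
    proof (intro ballI impI)
      fix S T
      assume "S \<in> ?\<S>" "T \<in> ?\<S>" "S \<noteq> T"
      \<comment> \<open>The support of \<open>b\<close> determines the box that contains it, so
        boxes for different supports are disjoint.\<close>
      then have "b \<notin> ?G T" if "b \<in> ?G S" for b
        using support_PiE[OF _ that] support_PiE[of T "{1..m}" b l] by auto
      then show "?G S \<inter> ?G T = {}"
        by blast
    qed
  qed
  also have "\<dots> = (\<Sum>S\<in>?\<S>. (l - 1) ^ j)"
  proof (rule sum.cong)
    fix S
    assume S: "S \<in> ?\<S>"
    have "card (?G S) = (\<Prod>i\<in>{1..m}. if i \<in> S then l - 1 else 1)"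
      unfolding card_PiE[OF finite_atLeastAtMost] by (intro prod.cong) auto
    also have "\<dots> = (\<Prod>i\<in>{1..m} \<inter> S. l - 1)"
      by (rule prod.inter_restrict[symmetric]) simp
    also have "\<dots> = (l - 1) ^ j"
      using S by (simp add: Int_absorb1)
    finally show "card (?G S) = (l - 1) ^ j" .
  qed simp
  also have "\<dots> = (m choose j) * (l - 1) ^ j"
    by (simp add: n_subsets)
  finally show ?thesis .
qed

section \<open>The Laplacians of the hyperlattice\<close>

lemma finite_hyperlattice_verts [simp]: "finite (hyperlattice_verts l m)"
  by (auto simp: hyperlattice_verts_def intro: finite_PiE)

lemma card_hyperlattice_verts: "card (hyperlattice_verts l m) = l ^ m"
  by (simp add: hyperlattice_verts_def card_PiE)

section \<open>Coordinate lines through a vertex\<close>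

lemma mem_coord_line_iff: "v \<in> coord_line l i u \<longleftrightarrow> v i < l \<and> v = u(i := v i)"
  by (auto simp: coord_line_def)

text \<open>The value of the base point at \<open>i\<close> is overwritten, so a line may be based
  at any of its points.\<close>

lemma coord_line_cong: "u(i := s) = v(i := t) \<Longrightarrow> coord_line l i u = coord_line l i v"
  unfolding coord_line_def by (metis fun_upd_upd)

lemma sum_coord_line: "(\<Sum>v\<in>coord_line l i u. f v) = (\<Sum>t<l. f (u(i := t)))"
proof -
  have "coord_line l i u = (\<lambda>t. u(i := t)) ` {..<l}"
    by (auto simp: coord_line_def)
  moreover have "inj_on (\<lambda>t. u(i := t)) {..<l}"
    by (rule inj_onI) (metis fun_upd_same)
  ultimately show ?thesis
    by (simp add: sum.reindex)
qed

lemma card_coord_line: "card (coord_line l i u) = l"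
  using sum_coord_line[of "\<lambda>_. 1 :: nat" l i u] by simp

lemma coord_line_subset_verts:
  assumes "u \<in> hyperlattice_verts l m" and "i \<in> {1..m}"
  shows "coord_line l i u \<subseteq> hyperlattice_verts l m"
  using assms by (auto simp: coord_line_def hyperlattice_verts_def PiE_iff extensional_def)

text \<open>A hyperedge through \<open>u\<close> can be rebased at \<open>u\<close>, after which
  only its direction is left to choose.\<close>

lemma edges_through_vertex:
  assumes "u \<in> hyperlattice_verts l m"
  shows "{e \<in> hyperlattice_edges l m. u \<in> e} = (\<lambda>i. coord_line l i u) ` {1..m}"
proof (intro equalityI subsetI)
  fix e
  assume "e \<in> {e \<in> hyperlattice_edges l m. u \<in> e}"
  then obtain i y where "i \<in> {1..m}" and e: "e = coord_line l i y" and "u \<in> coord_line l i y"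
    by (auto simp: hyperlattice_edges_def)
  then have "u(i := u i) = y(i := u i)"
    unfolding mem_coord_line_iff fun_upd_triv by (elim conjE)
  then have "e = coord_line l i u"
    unfolding e by (rule coord_line_cong[symmetric])
  then show "e \<in> (\<lambda>i. coord_line l i u) ` {1..m}"
    using \<open>i \<in> {1..m}\<close> by (rule image_eqI)
next
  fix e
  assume "e \<in> (\<lambda>i. coord_line l i u) ` {1..m}"
  then obtain i where i: "i \<in> {1..m}" and e: "e = coord_line l i u"
    by auto
  \<comment> \<open>Base points of hyperedges must be extensional on \<open>{1..m} - {i}\<close>,
    which forces \<open>undefined\<close> at \<open>i\<close>.\<close>
  have "u(i := undefined) \<in> ({1..m} - {i}) \<rightarrow>\<^sub>E {0..<l}"
    using assms by (auto simp: hyperlattice_verts_def PiE_iff extensional_def)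
  moreover have "e = coord_line l i (u(i := undefined))"
    unfolding e by (rule coord_line_cong[of _ _ 0 _ 0]) simp
  ultimately have "e \<in> hyperlattice_edges l m"
    using i by (auto simp: hyperlattice_edges_def)
  moreover have "u \<in> e"
    using assms i by (auto simp: e mem_coord_line_iff hyperlattice_verts_def PiE_mem)
  ultimately show "e \<in> {e \<in> hyperlattice_edges l m. u \<in> e}"
    by simp
qed

text \<open>If the lines in directions \<open>i \<noteq> j\<close> coincided, changing
  \<open>u\<close> at \<open>i\<close> would stay on a line where coordinate \<open>i\<close> is
  fixed. The two values \<open>0\<close> and \<open>1\<close>, available as
  \<open>l \<ge> 2\<close>, then contradict each other.\<close>

lemma inj_coord_line:
  assumes "l \<ge> 2"
  shows "inj (\<lambda>i. coord_line l i u)"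
proof (rule injI, rule ccontr)
  fix i j
  assume eq: "coord_line l i u = coord_line l j u" and "i \<noteq> j"
  have "u(i := t) = u" if "t < l" for t
  proof -
    have "u(i := t) \<in> coord_line l j u"
      using that unfolding eq[symmetric] by (simp add: mem_coord_line_iff)
    then show ?thesis
      using \<open>i \<noteq> j\<close> by (auto simp: mem_coord_line_iff fun_eq_iff)
  qed
  then have "u i = t" if "t < l" for t
    using that by (metis fun_upd_same)
  from this[of 0] this[of 1] assms show False
    by simp
qed

lemma card_edges_through_vertex:
  assumes "l \<ge> 2" and "u \<in> hyperlattice_verts l m"
  shows "card {e \<in> hyperlattice_edges l m. u \<in> e} = m"
  unfolding edges_through_vertex[OF assms(2)]
  by (subst card_image) (auto intro: inj_on_subset[OF inj_coord_line[OF assms(1)]])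

text \<open>The kernel of the sum of all line-summing operators. It counts directions instead of
  hyperedges and, unlike the clique adjacency, keeps its diagonal.\<close>

definition line_count :: "nat \<Rightarrow> nat \<Rightarrow> (nat \<Rightarrow> nat) \<Rightarrow> (nat \<Rightarrow> nat) \<Rightarrow> real" where
  "line_count l m u v = (\<Sum>i\<in>{1..m}. of_bool (v \<in> coord_line l i u))"

text \<open>Distinct directions give distinct lines through \<open>u\<close>, so hyperedges may be
  counted by direction.\<close>

lemma card_common_edges:
  assumes "l \<ge> 2" and "u \<in> hyperlattice_verts l m"
  shows "real (card {e \<in> hyperlattice_edges l m. u \<in> e \<and> v \<in> e}) = line_count l m u v"
proof -
  have "{e \<in> hyperlattice_edges l m. u \<in> e \<and> v \<in> e}
      = {e \<in> {e \<in> hyperlattice_edges l m. u \<in> e}. v \<in> e}"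
    by auto
  also have "\<dots> = (\<lambda>i. coord_line l i u) ` {i \<in> {1..m}. v \<in> coord_line l i u}"
    unfolding edges_through_vertex[OF assms(2)] by auto
  also have "card \<dots> = card {i \<in> {1..m}. v \<in> coord_line l i u}"
    by (rule card_image) (rule inj_on_subset[OF inj_coord_line[OF assms(1)] subset_UNIV])
  also have "real \<dots> = line_count l m u v"
    by (simp add: line_count_def Int_def)
  finally show ?thesis .
qed

section \<open>Adjacency and degrees through summation along lines\<close>

lemma line_count_same:
  assumes "u \<in> hyperlattice_verts l m"
  shows "line_count l m u u = real m"
  using assms by (simp add: line_count_def mem_coord_line_iff hyperlattice_verts_def PiE_iff)

lemma sum_line_count:
  assumes "u \<in> hyperlattice_verts l m"
  shows "(\<Sum>v\<in>hyperlattice_verts l m. line_count l m u v * f v)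
      = (\<Sum>i\<in>{1..m}. \<Sum>t<l. f (u(i := t)))"
proof -
  have "(\<Sum>v\<in>hyperlattice_verts l m. line_count l m u v * f v)
      = (\<Sum>i\<in>{1..m}. \<Sum>v\<in>hyperlattice_verts l m. of_bool (v \<in> coord_line l i u) * f v)"
    unfolding line_count_def sum_distrib_right by (rule sum.swap)
  also have "\<dots> = (\<Sum>i\<in>{1..m}. \<Sum>v\<in>coord_line l i u. f v)"
  proof (rule sum.cong)
    fix i
    assume "i \<in> {1..m}"
    then have "coord_line l i u \<subseteq> hyperlattice_verts l m"
      by (rule coord_line_subset_verts[OF assms])
    then show "(\<Sum>v\<in>hyperlattice_verts l m. of_bool (v \<in> coord_line l i u) * f v)
        = (\<Sum>v\<in>coord_line l i u. f v)"
      by (intro sum.mono_neutral_cong_right) auto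
  qed simp
  finally show ?thesis
    by (simp add: sum_coord_line)
qed

text \<open>One line per direction passes through \<open>u\<close>, so subtracting \<open>m\<close>
  restores the zero diagonal.\<close>

lemma clique_adj_hyperlattice:
  assumes "l \<ge> 2" and "u \<in> hyperlattice_verts l m"
  shows "clique_adj (hyperlattice_edges l m) u v = line_count l m u v - real m * of_bool (u = v)"
  using card_common_edges[OF assms, of v] line_count_same[OF assms(2)] by (auto simp: clique_adj_def)

text \<open>The \<open>m\<close> lines through \<open>u\<close> contribute \<open>l\<close> points
  each, and \<open>u\<close> itself is discounted once per line.\<close>

lemma clique_deg_hyperlattice:
  assumes "l \<ge> 2" and "u \<in> hyperlattice_verts l m"
  shows "clique_deg (hyperlattice_verts l m) (hyperlattice_edges l m) u = real m * (real l - 1)"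
proof -
  have lines: "(\<Sum>v\<in>hyperlattice_verts l m. line_count l m u v) = real m * real l"
    using sum_line_count[OF assms(2), of "\<lambda>_. 1"] by simp
  have "(\<Sum>v\<in>hyperlattice_verts l m. of_bool (u = v)) = (1 :: real)"
    using sum.delta[OF finite_hyperlattice_verts, of u "\<lambda>_. 1 :: real" l m] assms(2)
    by (simp only: of_bool_def if_True eq_commute[of u])
  then have diag: "(\<Sum>v\<in>hyperlattice_verts l m. real m * of_bool (u = v)) = real m"
    unfolding sum_distrib_left[symmetric] by (simp only: mult_1_right)
  show ?thesis
    unfolding clique_deg_def clique_adj_hyperlattice[OF assms] sum_subtractf lines diag
    by (simp add: right_diff_distrib)
qed

text \<open>The hypergraph is uniform: all hyperedges have \<open>l\<close> elements and hence the
  same weight \<open>1 / (l - 1)\<close>.\<close>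

lemma hyperedge_adj_hyperlattice:
  "hyperedge_adj (hyperlattice_edges l m) u v
    = clique_adj (hyperlattice_edges l m) u v / (real l - 1)"
proof -
  have "card e = l" if "e \<in> hyperlattice_edges l m" for e
    using that card_coord_line by (auto simp: hyperlattice_edges_def)
  then have "(\<Sum>e\<in>{e \<in> hyperlattice_edges l m. u \<in> e \<and> v \<in> e}. 1 / (real (card e) - 1))
      = (\<Sum>e\<in>{e \<in> hyperlattice_edges l m. u \<in> e \<and> v \<in> e}. 1 / (real l - 1))"
    by (intro sum.cong) simp_all
  then show ?thesis
    unfolding hyperedge_adj_def clique_adj_def by simp
qed

text \<open>Each direction with \<open>b i = 0\<close> removes one \<open>l\<close> from
  \<open>m * l\<close>; what is left is one \<open>l\<close> for each nonzero coordinate of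
  \<open>b\<close>.\<close>

lemma laplacian_prod_basis:
  assumes "l > 0" and u: "u \<in> hyperlattice_verts l m" and b: "b \<in> hyperlattice_verts l m"
  shows "(\<Sum>v\<in>hyperlattice_verts l m.
            (real m * real l * of_bool (u = v) - line_count l m u v) * prod_basis l m v b)
      = real (weight m b) * real l * prod_basis l m u b"
proof -
  have "(\<Sum>v\<in>hyperlattice_verts l m. line_count l m u v * prod_basis l m v b)
      = (\<Sum>i\<in>{1..m}. real l * of_bool (b i = 0) * prod_basis l m u b)"
    unfolding sum_line_count[OF u] using sum_line_prod_basis[OF assms(1) b] by (intro sum.cong) auto
  \<comment> \<open>Passing to the complementary indicator makes the weight of \<open>b\<close>
    appear directly.\<close>
  also have "\<dots> = (\<Sum>i\<in>{1..m}. real l * prod_basis l m u b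
      - of_bool (b i \<noteq> 0) * (real l * prod_basis l m u b))"
    by (intro sum.cong) auto
  also have "\<dots> = real m * real l * prod_basis l m u b
      - (\<Sum>i\<in>{1..m}. of_bool (b i \<noteq> 0)) * (real l * prod_basis l m u b)"
    unfolding sum_subtractf sum_distrib_right by simp
  also have "(\<Sum>i\<in>{1..m}. of_bool (b i \<noteq> 0)) = real (weight m b)"
    by (simp add: weight_def Int_def)
  finally have "(\<Sum>v\<in>hyperlattice_verts l m. line_count l m u v * prod_basis l m v b)
      = real m * real l * prod_basis l m u b - real (weight m b) * (real l * prod_basis l m u b)" .
  moreover have "(\<Sum>v\<in>hyperlattice_verts l m. real m * real l * of_bool (u = v) * prod_basis l m v b)
      = real m * real l * prod_basis l m u b"
  proof -
    have "(\<Sum>v\<in>hyperlattice_verts l m. real m * real l * of_bool (u = v) * prod_basis l m v b)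
        = (\<Sum>v\<in>hyperlattice_verts l m. if u = v then real m * real l * prod_basis l m v b else 0)"
      by (intro sum.cong) auto
    then show ?thesis
      using u by simp
  qed
  ultimately show ?thesis
    by (simp add: left_diff_distrib sum_subtractf)
qed

section \<open>The spectra of the two Laplacians\<close>

lemma weight_image:
  assumes "l \<ge> 2"
  shows "weight m ` hyperlattice_verts l m = {0..m}"
proof (intro equalityI subsetI)
  have "weight m b \<le> m" for b
    using card_mono[of "{1..m}" "{i \<in> {1..m}. b i \<noteq> 0}"] by (simp add: weight_def subset_iff)
  then show "j \<in> {0..m}" if "j \<in> weight m ` hyperlattice_verts l m" for j
    using that by auto
next
  fix j
  assume "j \<in> {0..m}"
  \<comment> \<open>The count \<open>(m choose j) * (l - 1) ^ j\<close> is positive because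
    \<open>j \<le> m\<close> and \<open>l \<ge> 2\<close>, so weight \<open>j\<close> is
    attained.\<close>
  then have "card {b \<in> hyperlattice_verts l m. weight m b = j} > 0"
    using assms by (simp add: card_weight)
  then show "j \<in> weight m ` hyperlattice_verts l m"
    by (auto simp: card_gt_0_iff)
qed

theorem proposition4:
  fixes l m :: nat and vs :: "(nat \<Rightarrow> nat) list"
  assumes "l \<ge> 2" and "m \<ge> 1"
    and "distinct vs" and "set vs = hyperlattice_verts l m"
  defines "E \<equiv> hyperlattice_edges l m"
  defines "A \<equiv> clique_adj_mat vs E"
    and "Lcl \<equiv> clique_laplacian vs E"
    and "Lh \<equiv> hyperedge_laplacian vs E"
  shows "(Lcl = (real m * (real l - 1)) \<cdot>\<^sub>m 1\<^sub>m (l ^ m) - A)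
    \<and> (spectrum Lcl = {real j * real l | j. j \<in> {0..m}})
    \<and> (card (spectrum Lcl) = m + 1)
    \<and> (\<forall>j\<in>{0..m}. has_multiplicity Lcl (real j * real l) ((m choose j) * (l - 1) ^ j))
    \<and> (Lh = real m \<cdot>\<^sub>m 1\<^sub>m (l ^ m) - (1 / (real l - 1)) \<cdot>\<^sub>m A)
    \<and> (Lh = (1 / (real l - 1)) \<cdot>\<^sub>m Lcl)
    \<and> (\<forall>v. (\<exists>c. eigenvector Lh v c) \<longleftrightarrow> (\<exists>c. eigenvector Lcl v c))
    \<and> (\<forall>j\<in>{0..m}. \<forall>v. eigenvector Lh v (real j * real l / (real l - 1))
                          \<longleftrightarrow> eigenvector Lcl v (real j * real l))
    \<and> (spectrum Lh = {real j * real l / (real l - 1) | j. j \<in> {0..m}})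
    \<and> (\<forall>j\<in>{0..m}. has_multiplicity Lh (real j * real l / (real l - 1))
                        ((m choose j) * (l - 1) ^ j))"
proof -
  let ?V = "hyperlattice_verts l m" and ?E = "hyperlattice_edges l m"
  let ?f = "\<lambda>u v. real m * real l * of_bool (u = v) - line_count l m u v"
  have l: "l > 0" and l1: "real l - 1 \<noteq> 0"
    using \<open>l \<ge> 2\<close> by auto
  have len: "length vs = l ^ m"
    using distinct_card[OF \<open>distinct vs\<close>] assms(4) card_hyperlattice_verts by simp
  have nth_V: "vs ! i \<in> ?V" if "i < l ^ m" for i
    using that len assms(4) nth_mem[of i vs] by auto
  have nth_eq: "vs ! i = vs ! j \<longleftrightarrow> i = j" if "i < l ^ m" "j < l ^ m" for i j
    using that len \<open>distinct vs\<close> by (simp add: nth_eq_iff_index_eq)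
  have A_carrier: "A \<in> carrier_mat (l ^ m) (l ^ m)"
    by (simp add: A_def clique_adj_mat_def matrix_on_def len)
  have Lcl: "Lcl = (real m * (real l - 1)) \<cdot>\<^sub>m 1\<^sub>m (l ^ m) - A"
    by (rule eq_matI)
      (auto simp: Lcl_def A_def E_def clique_laplacian_def clique_adj_mat_def diagonal_on_def
        matrix_on_def len nth_eq nth_V assms(4) clique_deg_hyperlattice[OF \<open>l \<ge> 2\<close>])
  have Lh: "Lh = real m \<cdot>\<^sub>m 1\<^sub>m (l ^ m) - (1 / (real l - 1)) \<cdot>\<^sub>m A"
    by (rule eq_matI)
      (auto simp: Lh_def A_def E_def hyperedge_laplacian_def clique_adj_mat_def diagonal_on_def
        matrix_on_def len nth_eq nth_V hyperedge_adj_hyperlattice hyperedge_deg_def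
        card_edges_through_vertex[OF \<open>l \<ge> 2\<close>])
  have Lh_Lcl: "Lh = (1 / (real l - 1)) \<cdot>\<^sub>m Lcl"
    unfolding Lh Lcl using A_carrier l1 by (intro eq_matI) (auto simp: field_simps)
  \<comment> \<open>The degree \<open>m * (l - 1)\<close> and the \<open>m\<close> split off from
    the diagonal of \<open>line_count\<close> combine to \<open>m * l\<close>.\<close>
  have Lcl_f: "Lcl = matrix_on vs ?f"
    unfolding Lcl
    by (rule eq_matI)
      (auto simp: A_def E_def clique_adj_mat_def matrix_on_def len nth_eq nth_V
        clique_adj_hyperlattice[OF \<open>l \<ge> 2\<close>] algebra_simps)
  have Lh_f: "Lh = matrix_on vs (\<lambda>u v. ?f u v / (real l - 1))"
    unfolding Lh_Lcl Lcl_f by (rule eq_matI) (auto simp: matrix_on_def)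
  have carrier: "Lcl \<in> carrier_mat (l ^ m) (l ^ m)" "Lh \<in> carrier_mat (l ^ m) (l ^ m)"
    unfolding Lcl_f Lh_f using len by (auto simp: matrix_on_def)
  let ?d = "\<lambda>b. real (weight m b) * real l"
  have jnf_cl: "jordan_nf Lcl (map (\<lambda>b. (1, ?d b)) vs)"
    unfolding Lcl_f
    by (rule jordan_nf_matrix_on[where P = "prod_basis_inv m" and Q = "prod_basis l m"])
      (use \<open>distinct vs\<close> in \<open>simp_all add: assms(4) prod_basis_inverse[OF l] laplacian_prod_basis[OF l]\<close>)
  \<comment> \<open>The same basis diagonalises \<open>Lh\<close>, with all eigenvalues divided by
    \<open>l - 1\<close>.\<close>
  have jnf_h: "jordan_nf Lh (map (\<lambda>b. (1, ?d b / (real l - 1))) vs)"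
    unfolding Lh_f
  proof (rule jordan_nf_matrix_on[where P = "prod_basis_inv m" and Q = "prod_basis l m"])
    fix u b
    assume "u \<in> set vs" "b \<in> set vs"
    then show "(\<Sum>w\<in>set vs. ?f u w / (real l - 1) * prod_basis l m w b)
        = ?d b / (real l - 1) * prod_basis l m u b"
      using laplacian_prod_basis[OF l, of u m b]
      by (simp add: assms(4) sum_divide_distrib[symmetric])
  qed (use \<open>distinct vs\<close> in \<open>simp_all add: assms(4) prod_basis_inverse[OF l]\<close>)
  have spec_cl: "spectrum Lcl = (\<lambda>j. real j * real l) ` {0..m}"
    unfolding spectrum_jordan_nf_size_one[OF carrier(1) jnf_cl] weight_image[OF \<open>l \<ge> 2\<close>, symmetric]
    by (simp add: image_image assms(4))
  have spec_h: "spectrum Lh = (\<lambda>j. real j * real l / (real l - 1)) ` {0..m}"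
    unfolding spectrum_jordan_nf_size_one[OF carrier(2) jnf_h] weight_image[OF \<open>l \<ge> 2\<close>, symmetric]
    by (simp add: image_image assms(4))
  have "card (spectrum Lcl) = m + 1"
    unfolding spec_cl using l by (subst card_image) (auto intro: inj_onI)
  \<comment> \<open>As \<open>l > 0\<close>, the eigenvalue \<open>j * l\<close> belongs exactly to
    the basis functions of weight \<open>j\<close>.\<close>
  moreover have "has_multiplicity Lcl (real j * real l) ((m choose j) * (l - 1) ^ j)" for j
    using has_multiplicity_jordan_nf_size_one[OF \<open>distinct vs\<close> carrier(1) jnf_cl, of "real j * real l"]
      card_weight[OF l, of m j] l by (simp add: assms(4))
  moreover have "has_multiplicity Lh (real j * real l / (real l - 1)) ((m choose j) * (l - 1) ^ j)"
    for j
    using has_multiplicity_jordan_nf_size_one[OF \<open>distinct vs\<close> carrier(2) jnf_h,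
        of "real j * real l / (real l - 1)"]
      card_weight[OF l, of m j] l l1 by (simp add: assms(4))
  moreover have eigenvector: "eigenvector Lh v (c / (real l - 1)) \<longleftrightarrow> eigenvector Lcl v c" for v c
    unfolding Lh_Lcl using eigenvector_smult[OF carrier(1), of "1 / (real l - 1)" v c] l1 by simp
  moreover have "(\<exists>c. eigenvector Lh v c) \<longleftrightarrow> (\<exists>c. eigenvector Lcl v c)" for v
  proof
    assume "\<exists>c. eigenvector Lh v c"
    \<comment> \<open>Since \<open>l - 1\<close> is nonzero, every eigenvalue of \<open>Lh\<close>
      has the form required by the scaling equivalence.\<close>
    then obtain c where "eigenvector Lh v (c * (real l - 1) / (real l - 1))"
      using l1 by auto
    then show "\<exists>c. eigenvector Lcl v c"
      unfolding eigenvector ..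
  qed (use eigenvector in blast)
  ultimately show ?thesis
    using Lcl Lh Lh_Lcl spec_cl spec_h by (auto simp: image_def)
qed

end
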